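(* Assume that the Collatz map $T$ has no divergent trajectories, i.e. there is no $n\in\mathbb{N}^*$ with $T^k(n)\to\infty$ as $k\to\infty$. Then the average operator $\mathcal{K}\colon\ell_1\to\ell_1$, $$\mathcal{K}(x)=\lim_{k\to\infty}\frac{x+L_{T,1}(x)+\cdots+L_{T,1}^{k-1}(x)}{k}\qquad(\text{limit in the norm of }\ell_1),$$ is well-defined (the limit exists for every $x\in\ell_1$) and is a bounded linear operator with $\|\mathcal{K}\|=1$.
   Context: $\mathbb{N}^*=\{1,2,3,\dots\}$. The Collatz map $T\colon\mathbb{N}^*\to\mathbb{N}^*$ is $T(n)=n/2$ for $n$ even and $T(n)=(3n+1)/2$ for $n$ odd. $\ell_1$ is the usual space of absolutely summable scalar sequences indexed by $\mathbb{N}^*$ with unit vectors $(e_n)$. $L_{T,1}\colon\ell_1\to\ell_1$ is the bounded linear operator $L_{T,1}\left(\sum_n x_ne_n\right)=\sum_n x_ne_{T(n)}$. *)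

theory Defs
  imports "HOL-Analysis.Analysis"
begin

text \<open>
  The positive integers are the set \<open>{1..}\<close> of natural numbers. \<open>collatz\<close> maps this set to itself;
  its value at \<open>0\<close> is immaterial.
\<close>

definition collatz :: "nat \<Rightarrow> nat" where
  "collatz n = (if even n then n div 2 else (3 * n + 1) div 2)"

text \<open>
  Scalars range over a complete normed field, that is, over the reals or the complex numbers.
  A sequence indexed by the positive integers is a function on \<open>nat\<close>, padded with \<open>0\<close> at index \<open>0\<close>
  so that equality of sequences is equality of functions.
\<close>

typedef (overloaded) ('a::"{real_normed_field, banach}") ell1 =
  "{x :: nat \<Rightarrow> 'a. x 0 = 0 \<and> (\<lambda>n. norm (x n)) summable_on {1..}}"
  morphisms coord Abs_ell1
  by (rule exI[of _ "\<lambda>_. 0"]) simp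

setup_lifting type_definition_ell1

lemma ell1_eqI: "(\<And>n. coord x n = coord y n) \<Longrightarrow> x = y"
  by (metis coord_inject ext)

lemma coord_0 [simp]: "coord x 0 = 0"
  using coord[of x] by simp

lemma coord_summable: "(\<lambda>n. norm (coord x n)) summable_on {1..}"
  using coord[of x] by simp

lemma norm_summable_on_add:
  fixes f g :: "nat \<Rightarrow> 'a::real_normed_vector"
  assumes "(\<lambda>n. norm (f n)) summable_on A" "(\<lambda>n. norm (g n)) summable_on A"
  shows "(\<lambda>n. norm (f n + g n)) summable_on A"
  by (rule summable_on_comparison_test[OF summable_on_add[OF assms]])
     (auto intro: norm_triangle_ineq)

instantiation ell1 :: ("{real_normed_field, banach}") real_vector
begin

lift_definition zero_ell1 :: "'a ell1" is "\<lambda>_. 0" by simp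

lift_definition plus_ell1 :: "'a ell1 \<Rightarrow> 'a ell1 \<Rightarrow> 'a ell1" is "\<lambda>x y n. x n + y n"
  by (simp add: norm_summable_on_add)

lift_definition uminus_ell1 :: "'a ell1 \<Rightarrow> 'a ell1" is "\<lambda>x n. - x n" by simp

lift_definition minus_ell1 :: "'a ell1 \<Rightarrow> 'a ell1 \<Rightarrow> 'a ell1" is "\<lambda>x y n. x n - y n"
  using norm_summable_on_add[where g = "\<lambda>n. - h n" for h] by (fastforce simp: norm_minus_cancel)

lift_definition scaleR_ell1 :: "real \<Rightarrow> 'a ell1 \<Rightarrow> 'a ell1" is "\<lambda>c x n. c *\<^sub>R x n"
  by (simp add: summable_on_cmult_right)

instance
  by standard (transfer; simp add: algebra_simps fun_eq_iff)+

end

lift_definition smul :: "'a::{real_normed_field, banach} \<Rightarrow> 'a ell1 \<Rightarrow> 'a ell1"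
  is "\<lambda>c x n. c * x n"
  by (simp add: norm_mult summable_on_cmult_right)

lemma vector_space_smul: "vector_space (smul :: 'a::{real_normed_field, banach} \<Rightarrow> _)"
  by standard (transfer; simp add: algebra_simps fun_eq_iff)+

instantiation ell1 :: ("{real_normed_field, banach}") real_normed_vector
begin

definition norm_ell1 :: "'a ell1 \<Rightarrow> real" where
  "norm_ell1 x = (\<Sum>\<^sub>\<infinity>n\<in>{1..}. norm (coord x n))"

definition sgn_ell1 :: "'a ell1 \<Rightarrow> 'a ell1" where
  "sgn_ell1 x = x /\<^sub>R norm x"

definition dist_ell1 :: "'a ell1 \<Rightarrow> 'a ell1 \<Rightarrow> real" where
  "dist_ell1 x y = norm (x - y)"

definition uniformity_ell1 :: "('a ell1 \<times> 'a ell1) filter" where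
  "uniformity_ell1 = (INF e\<in>{0<..}. principal {(x, y). dist x y < e})"

definition open_ell1 :: "'a ell1 set \<Rightarrow> bool" where
  "open_ell1 U \<longleftrightarrow> (\<forall>x\<in>U. eventually (\<lambda>(x', y). x' = x \<longrightarrow> y \<in> U) uniformity)"

instance
proof
  fix x y :: "'a ell1" and c :: real
  show "(norm x = 0) = (x = 0)"
  proof
    assume "norm x = 0"
    then have "norm (coord x n) = 0" if "n \<in> {1..}" for n
      using \<open>norm x = 0\<close> by (intro nonneg_infsum_le_0D[OF _ coord_summable _ that])
        (simp_all add: norm_ell1_def)
    then have "coord x n = 0" for n
      by (cases n) auto
    then show "x = 0"
      by (intro ell1_eqI) (simp add: zero_ell1.rep_eq)
  qed (simp add: norm_ell1_def zero_ell1.rep_eq)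
  have s: "(\<lambda>n. norm (coord x n + coord y n)) summable_on {1..}"
    by (intro norm_summable_on_add coord_summable)
  show "norm (x + y) \<le> norm x + norm y"
    unfolding norm_ell1_def plus_ell1.rep_eq infsum_add[OF coord_summable coord_summable, symmetric]
    by (intro infsum_mono s summable_on_add coord_summable norm_triangle_ineq)
  show "norm (c *\<^sub>R x) = \<bar>c\<bar> * norm x"
    by (simp add: norm_ell1_def scaleR_ell1.rep_eq infsum_cmult_right')
qed (simp_all add: sgn_ell1_def dist_ell1_def uniformity_ell1_def open_ell1_def)

end

lemma norm_smul: "norm (smul c x) = norm c * norm x"
  by (simp add: norm_ell1_def smul.rep_eq norm_mult infsum_cmult_right')

lemma norm_coord_sum_le: "finite F \<Longrightarrow> F \<subseteq> {1..} \<Longrightarrow> (\<Sum>n\<in>F. norm (coord x n)) \<le> norm x"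
  unfolding norm_ell1_def by (intro finite_sum_le_infsum coord_summable) auto

lemma norm_coord_le: "norm (coord x n) \<le> norm x"
  using norm_coord_sum_le[of "{n}" x] by (cases n) auto

lemma norm_le_if_sums_le:
  assumes "\<And>F. finite F \<Longrightarrow> F \<subseteq> {1..} \<Longrightarrow> (\<Sum>n\<in>F. norm (coord x n)) \<le> B"
  shows "norm x \<le> B"
  unfolding norm_ell1_def by (intro infsum_le_finite_sums coord_summable assms)

instance ell1 :: ("{real_normed_field, banach}") banach
proof
  fix X :: "nat \<Rightarrow> 'a ell1"
  assume X: "Cauchy X"
  have "Cauchy (\<lambda>i. coord (X i) n)" for n
  proof (rule CauchyI)
    fix e :: real assume "e > 0"
    then obtain M where M: "\<And>i j. i \<ge> M \<Longrightarrow> j \<ge> M \<Longrightarrow> norm (X i - X j) < e"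
      using CauchyD[OF X] by blast
    have "norm (coord (X i) n - coord (X j) n) < e" if "i \<ge> M" "j \<ge> M" for i j
      using norm_coord_le[of "X i - X j" n] M[OF that] by (simp add: minus_ell1.rep_eq)
    then show "\<exists>M. \<forall>i\<ge>M. \<forall>j\<ge>M. norm (coord (X i) n - coord (X j) n) < e"
      by blast
  qed
  then have "\<exists>l. (\<lambda>i. coord (X i) n) \<longlonglongrightarrow> l" for n
    using Cauchy_convergent convergent_def by blast
  then obtain g where g: "\<And>n. (\<lambda>i. coord (X i) n) \<longlonglongrightarrow> g n"
    by metis
  have close: "(\<Sum>n\<in>F. norm (coord (X i) n - g n)) \<le> e"
    if M: "\<And>i j. i \<ge> M \<Longrightarrow> j \<ge> M \<Longrightarrow> norm (X i - X j) < e"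
      and i: "i \<ge> M" and F: "finite F" "F \<subseteq> {1..}" for M e i F
  proof (rule LIMSEQ_le_const2)
    show "(\<lambda>j. \<Sum>n\<in>F. norm (coord (X i) n - coord (X j) n)) \<longlonglongrightarrow> (\<Sum>n\<in>F. norm (coord (X i) n - g n))"
      by (intro tendsto_intros g)
    show "\<exists>N. \<forall>j\<ge>N. (\<Sum>n\<in>F. norm (coord (X i) n - coord (X j) n)) \<le> e"
    proof (intro exI[of _ M] allI impI)
      fix j assume "j \<ge> M"
      then show "(\<Sum>n\<in>F. norm (coord (X i) n - coord (X j) n)) \<le> e"
        using norm_coord_sum_le[OF F, of "X i - X j"] M[OF i, of j] by (simp add: minus_ell1.rep_eq)
    qed
  qed
  obtain M where M: "\<And>i j. i \<ge> M \<Longrightarrow> j \<ge> M \<Longrightarrow> norm (X i - X j) < 1"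
    using CauchyD[OF X, of 1] by auto
  have "(\<lambda>n. norm (coord (X M) n - g n)) summable_on {1..}"
    by (rule nonneg_bdd_above_summable_on)
       (use close[OF M] in \<open>auto intro!: bdd_aboveI[where M = 1]\<close>)
  from norm_summable_on_add[OF coord_summable[of "X M"], of "\<lambda>n. g n - coord (X M) n"] this
  have gs: "(\<lambda>n. norm (g n)) summable_on {1..}"
    by (simp add: norm_minus_commute)
  have g0: "g 0 = 0"
    using LIMSEQ_unique[OF g[of 0]] by simp
  define G where "G = Abs_ell1 g"
  have G: "coord G = g"
    unfolding G_def using gs g0 by (simp add: Abs_ell1_inverse)
  have "X \<longlonglongrightarrow> G"
  proof (rule LIMSEQ_I)
    fix r :: real assume "r > 0"
    then obtain M where M: "\<And>i j. i \<ge> M \<Longrightarrow> j \<ge> M \<Longrightarrow> norm (X i - X j) < r / 2"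
      using CauchyD[OF X, of "r / 2"] by auto
    have "norm (X i - G) \<le> r / 2" if "i \<ge> M" for i
      by (rule norm_le_if_sums_le) (use close[OF M that] in \<open>simp add: minus_ell1.rep_eq G\<close>)
    then show "\<exists>no. \<forall>n\<ge>no. norm (X n - G) < r"
      using \<open>r > 0\<close> by (intro exI[of _ M] allI impI) (smt (verit) field_sum_of_halves)
  qed
  then show "convergent X"
    by (rule convergentI)
qed

text \<open>The unit vectors are \<open>unit_vec n\<close> for \<open>n \<ge> 1\<close>; the value \<open>unit_vec 0 = 0\<close> is a dummy.\<close>

lift_definition unit_vec :: "nat \<Rightarrow> 'a::{real_normed_field, banach} ell1"
  is "\<lambda>n m. if m = n \<and> n \<noteq> 0 then 1 else 0"
proof -
  fix n :: nat
  have "(\<lambda>m. norm (if m = n \<and> n \<noteq> 0 then 1 else 0 :: 'a)) summable_on {1..}"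
    by (rule finite_nonzero_values_imp_summable_on)
       (rule finite_subset[of _ "{n}"], auto)
  moreover have "(if 0 = n \<and> n \<noteq> 0 then 1 else 0 :: 'a) = 0"
    by auto
  ultimately show "(if 0 = n \<and> n \<noteq> 0 then 1 else 0 :: 'a) = 0
      \<and> (\<lambda>m. norm (if m = n \<and> n \<noteq> 0 then 1 else 0 :: 'a)) summable_on {1..}"
    by (rule conjI[rotated])
qed

text \<open>The sum below is an unordered sum in the norm of the sequence space.\<close>

definition L_T1 :: "'a::{real_normed_field, banach} ell1 \<Rightarrow> 'a ell1" where
  "L_T1 x = (\<Sum>\<^sub>\<infinity>n\<in>{1..}. smul (coord x n) (unit_vec (collatz n)))"

text \<open>
  The lemmas \<open>smul_unit_vec_summable\<close> and \<open>ell1_expansion\<close> below show that the sum defining \<open>L_T1\<close> converges for every \<open>x\<close> (absolutely), and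
  that \<open>coord x\<close> is the coefficient sequence of \<open>x\<close> with respect to the unit vectors.
\<close>

lemma norm_unit_vec_le: "norm (unit_vec n) \<le> 1"
proof (rule norm_le_if_sums_le)
  fix F :: "nat set" assume F: "finite F"
  have "(\<Sum>m\<in>F. norm (coord (unit_vec n :: 'a ell1) m)) \<le> (\<Sum>m\<in>F. if m = n then 1 else 0)"
    by (intro sum_mono) (simp add: unit_vec.rep_eq)
  also have "\<dots> \<le> 1"
    using F by simp
  finally show "(\<Sum>m\<in>F. norm (coord (unit_vec n :: 'a ell1) m)) \<le> 1" .
qed

lemma smul_unit_vec_summable: "(\<lambda>n. smul (coord x n) (unit_vec (f n))) summable_on {1..}"
proof (rule abs_summable_summable, rule summable_on_comparison_test[OF coord_summable[of x]])
  fix n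
  show "norm (smul (coord x n) (unit_vec (f n))) \<le> norm (coord x n)"
    unfolding norm_smul by (rule mult_left_le[OF norm_unit_vec_le norm_ge_zero])
qed simp

lemma ell1_expansion: "((\<lambda>n. smul (coord x n) (unit_vec n)) has_sum x) {1..}"
proof -
  let ?f = "\<lambda>n. smul (coord x n) (unit_vec n)"
  have bl: "bounded_linear (\<lambda>y :: 'a ell1. coord y m)" for m
    by (rule bounded_linear_intro[of _ 1])
       (simp_all add: plus_ell1.rep_eq scaleR_ell1.rep_eq norm_coord_le)
  have "infsum ?f {1..} = x"
  proof (rule ell1_eqI)
    fix m
    have "coord (infsum ?f {1..}) m = (\<Sum>\<^sub>\<infinity>n\<in>{1..}. coord (?f n) m)"
      using infsumI[OF has_sum_bounded_linear[OF bl has_sum_infsum[OF smul_unit_vec_summable[of x "\<lambda>n. n"]]]]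
      by (rule sym)
    also have "\<dots> = (\<Sum>\<^sub>\<infinity>n\<in>{1..}. if n = m then coord x m else 0)"
      by (rule infsum_cong) (simp add: smul.rep_eq unit_vec.rep_eq)
    also have "\<dots> = coord x m"
    proof (cases "m = 0")
      case False
      then have "(\<Sum>\<^sub>\<infinity>n\<in>{1..}. if n = m then coord x m else 0) = (\<Sum>\<^sub>\<infinity>n\<in>{m}. coord x m)"
        by (intro infsum_cong_neutral) auto
      then show ?thesis by simp
    next
      case True
      then show ?thesis by (simp add: infsum_0)
    qed
    finally show "coord (infsum ?f {1..}) m = coord x m" .
  qed
  then show ?thesis
    using has_sum_infsum[OF smul_unit_vec_summable[of x "\<lambda>n. n"]] by simp
qed

definition cesaro :: "nat \<Rightarrow> 'a::{real_normed_field, banach} ell1 \<Rightarrow> 'a ell1" where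
  "cesaro k x = (1 / real k) *\<^sub>R (\<Sum>j<k. (L_T1 ^^ j) x)"

definition average_operator :: "'a::{real_normed_field, banach} ell1 \<Rightarrow> 'a ell1" where
  "average_operator x = lim (\<lambda>k. cesaro k x)"

end

theory Submission
  imports Defs
begin

text \<open>
  Write \<open>L\<close> for \<open>L_T1\<close> and \<open>C\<^sub>k\<close> for the averages \<open>cesaro k\<close>
  and \<open>K\<close> for their limit \<open>average_operator\<close>. On a unit vector, the averages are the
  Cesaro means of the sequence of unit vectors along a Collatz trajectory. A trajectory that does
  not tend to infinity stays below some bound infinitely often, so it takes some value twice and is eventually periodic
  (\<open>nondivergent_orbit_eventually_periodic\<close>), and the Cesaro means of an eventually periodic
  sequence converge to its mean over one period (\<open>cesaro_means_eventually_periodic\<close>). So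
  \<open>C\<^sub>k x\<close> converges for every \<open>x\<close> in the span of the unit vectors.

  The passage to all \<open>x\<close> is a density argument: \<open>L\<close> is a contraction, hence so is every \<open>C\<^sub>k\<close>, and for a
  sequence of contractions into a complete space the set of points of convergence is closed
  (\<open>closed_convergent_points\<close>); the span of the unit vectors is dense by \<open>ell1_expansion\<close>.

  Linearity and the bound \<open>norm (K x) \<le> norm x\<close> survive the limit. The norm is attained because
  \<open>{1, 2}\<close> is a cycle of the Collatz map: the sum of the first two unit vectors is a nonzero
  fixed point of \<open>L\<close>, hence of \<open>K\<close>.
\<close>

section \<open>Orbits and Cesaro means\<close>

lemma nondivergent_orbit_eventually_periodic:
  fixes f :: "nat \<Rightarrow> nat"
  assumes "\<not> filterlim (\<lambda>k. (f ^^ k) n) at_top sequentially"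
  obtains m p where "p > 0" "\<And>j. j \<ge> m \<Longrightarrow> (f ^^ (j + p)) n = (f ^^ j) n"
proof -
  from assms obtain Z where "\<not> eventually (\<lambda>k. Z \<le> (f ^^ k) n) sequentially"
    by (auto simp: filterlim_at_top)
  then have "\<exists>\<^sub>F k in sequentially. (f ^^ k) n < Z"
    by (simp add: frequently_def not_less)
  then have inf: "infinite {k. (f ^^ k) n < Z}"
    by (simp add: INFM_iff_infinite flip: cofinite_eq_sequentially)
  have "finite ((\<lambda>k. (f ^^ k) n) ` {k. (f ^^ k) n < Z})"
    by (rule finite_subset[of _ "{..<Z}"]) auto
  then have "\<not> inj_on (\<lambda>k. (f ^^ k) n) {k. (f ^^ k) n < Z}"
    using inf finite_imageD by blast
  then obtain a b where "a \<noteq> b" "(f ^^ a) n = (f ^^ b) n"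
    by (auto simp: inj_on_def)
  then obtain a b where ab: "a < b" "(f ^^ a) n = (f ^^ b) n"
    by (metis linorder_neqE_nat)
  show thesis
  proof (rule that[of "b - a" a])
    show "b - a > 0" using ab by simp
    fix j assume "j \<ge> a"
    then have j: "j = (j - a) + a" "j + (b - a) = (j - a) + b"
      using ab by auto
    show "(f ^^ (j + (b - a))) n = (f ^^ j) n"
      using ab(2) by (subst j(2), subst (2) j(1)) (simp add: funpow_add)
  qed
qed

text \<open>
  The deviation of the partial sums from the linear function with slope the mean over one period is
  itself eventually periodic, hence bounded, and dividing by \<open>k\<close> makes it vanish.
\<close>

lemma cesaro_means_eventually_periodic:
  fixes f :: "nat \<Rightarrow> 'b::real_normed_vector"
  assumes p: "p > 0" and per: "\<And>j. j \<ge> m \<Longrightarrow> f (j + p) = f j"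
  shows "(\<lambda>k. (1 / real k) *\<^sub>R (\<Sum>j<k. f j)) \<longlonglongrightarrow> (1 / real p) *\<^sub>R (\<Sum>j<p. f (m + j))"
proof -
  define c where "c = (1 / real p) *\<^sub>R (\<Sum>j<p. f (m + j))"
  define D where "D k = (\<Sum>j<k. f j) - real k *\<^sub>R c" for k
  have pc: "real p *\<^sub>R c = (\<Sum>j<p. f (m + j))"
    using p by (simp add: c_def)
  have split: "(\<Sum>j<a + b. f j) = (\<Sum>j<a. f j) + (\<Sum>j<b. f (a + j))" for a b
    by (induction b) (simp_all add: add.assoc)
  \<comment> \<open>Past \<open>m\<close>, the sum over one period does not depend on where the period starts.\<close>
  have window: "(\<Sum>j<p. f (m + i + j)) = (\<Sum>j<p. f (m + j))" for i
  proof (induction i)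
    case (Suc i)
    have "(\<Sum>j<p. f (m + Suc i + j)) + f (m + i) = (\<Sum>j<Suc p. f (m + i + j))"
      by (subst sum.lessThan_Suc_shift) (simp add: add.commute)
    also have "\<dots> = (\<Sum>j<p. f (m + i + j)) + f (m + i)"
      using per[of "m + i"] by simp
    finally show ?case using Suc by simp
  qed simp
  have D_per: "D (k + p) = D k" if "k \<ge> m" for k
  proof -
    have "(\<Sum>j<k + p. f j) = (\<Sum>j<k. f j) + real p *\<^sub>R c"
      using window[of "k - m"] that by (simp add: split pc)
    then show ?thesis
      by (simp add: D_def scaleR_add_left)
  qed
  have D_range: "D k \<in> D ` {..<m + p}" for k
  proof (induction k rule: less_induct)
    case (less k)
    show ?case
    proof (cases "k < m + p")
      case False
      then have "D k = D (k - p)"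
        using D_per[of "k - p"] by simp
      with less[of "k - p"] False p show ?thesis by simp
    qed auto
  qed
  then have "range D \<subseteq> D ` {..<m + p}" by blast
  then have "bounded (range D)"
    by (meson finite_imageI finite_imp_bounded finite_lessThan bounded_subset)
  then obtain B where B: "\<And>k. norm (D k) \<le> B"
    by (auto simp: bounded_iff)
  have "(\<lambda>k. (1 / real k) *\<^sub>R D k) \<longlonglongrightarrow> 0"
  proof (rule Lim_null_comparison)
    show "\<forall>\<^sub>F k in sequentially. norm ((1 / real k) *\<^sub>R D k) \<le> B / real k"
      using B by (auto intro!: always_eventually divide_right_mono)
    show "(\<lambda>k. B / real k) \<longlonglongrightarrow> 0"
      by (rule lim_const_over_n)
  qed
  then have "(\<lambda>k. (1 / real k) *\<^sub>R D k + c) \<longlonglongrightarrow> 0 + c"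
    by (intro tendsto_intros)
  moreover have "\<forall>\<^sub>F k in sequentially. (1 / real k) *\<^sub>R D k + c = (1 / real k) *\<^sub>R (\<Sum>j<k. f j)"
    using eventually_gt_at_top[of "0::nat"]
    by eventually_elim (simp add: D_def scaleR_diff_right)
  ultimately show ?thesis
    unfolding c_def[symmetric] by (simp add: tendsto_cong)
qed

text \<open>
  If \<open>y\<close> is a point of convergence, then the sequence at \<open>x\<close> stays within \<open>dist x y\<close> of a Cauchy
  sequence; when \<open>dist x y\<close> can be made arbitrarily small, the sequence at \<open>x\<close> is itself Cauchy.
\<close>

lemma closed_convergent_points:
  fixes C :: "nat \<Rightarrow> 'a::metric_space \<Rightarrow> 'b::complete_space"
  assumes contr: "\<And>k x y. dist (C k x) (C k y) \<le> dist x y"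
  shows "closed {x. convergent (\<lambda>k. C k x)}"
proof (subst closure_subset_eq[symmetric], intro subsetI, unfold mem_Collect_eq)
  fix x assume x: "x \<in> closure {x. convergent (\<lambda>k. C k x)}"
  have "Cauchy (\<lambda>k. C k x)"
  proof (rule metric_CauchyI)
    fix e :: real assume "e > 0"
    then have "e / 3 > 0" by simp
    with x obtain y where y: "convergent (\<lambda>k. C k y)" "dist y x < e / 3"
      unfolding closure_approachable by blast
    then obtain M where M: "\<And>i j. i \<ge> M \<Longrightarrow> j \<ge> M \<Longrightarrow> dist (C i y) (C j y) < e / 3"
      using metric_CauchyD[OF convergent_Cauchy[OF y(1)] \<open>e / 3 > 0\<close>] by auto
    have "dist (C i x) (C j x) < e" if "i \<ge> M" "j \<ge> M" for i j
      using contr[of i y x] contr[of j y x] M[OF that] y(2)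
        dist_triangle[of "C i x" "C j x" "C i y"] dist_triangle[of "C i y" "C j x" "C j y"]
      by (simp add: dist_commute)
    then show "\<exists>M. \<forall>i\<ge>M. \<forall>j\<ge>M. dist (C i x) (C j x) < e" by blast
  qed
  then show "convergent (\<lambda>k. C k x)"
    by (rule Cauchy_convergent)
qed

section \<open>The Collatz operator and its averages\<close>

text \<open>
  The operator, its powers, its averages and their limit all have the following property, which
  passes from each to the next. It implies real linearity too, by \<open>scaleR_eq_smul\<close>.
\<close>

definition linear_contraction :: "('a::{real_normed_field, banach} ell1 \<Rightarrow> 'a ell1) \<Rightarrow> bool" where
  "linear_contraction F \<longleftrightarrow> (\<forall>x y. F (x + y) = F x + F y) \<and> (\<forall>c x. F (smul c x) = smul c (F x))
    \<and> (\<forall>x. norm (F x) \<le> norm x)"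

lemma linear_contractionD:
  assumes "linear_contraction F"
  shows "F (x + y) = F x + F y" "F (smul c x) = smul c (F x)" "norm (F x) \<le> norm x"
  using assms by (auto simp: linear_contraction_def)

lemma scaleR_eq_smul: "r *\<^sub>R x = smul (of_real r) x"
  by transfer (simp add: scaleR_conv_of_real)

lemma smul_add_left: "smul (a + b) x = smul a x + smul b x"
  by transfer (simp add: algebra_simps)

lemma smul_add_right: "smul a (x + y) = smul a x + smul a y"
  by transfer (simp add: algebra_simps)

lemma smul_smul: "smul a (smul b x) = smul (a * b) x"
  by transfer (simp add: algebra_simps)

lemma smul_scaleR: "smul a (r *\<^sub>R x) = r *\<^sub>R smul a x"
  by (simp add: scaleR_eq_smul smul_smul mult.commute)

lemma bounded_linear_smul: "bounded_linear (smul c)"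
  by (rule bounded_linear_intro[of _ "norm c"])
     (simp_all add: smul_add_right smul_scaleR norm_smul mult.commute)

lemma linear_contraction_bounded_linear:
  assumes "linear_contraction F"
  shows "bounded_linear F"
  by (intro bounded_linear_intro[of _ 1])
     (simp_all add: linear_contractionD[OF assms] scaleR_eq_smul)

lemma linear_contraction_linear:
  assumes "linear_contraction F"
  shows "Vector_Spaces.linear smul smul F"
  by (simp add: Vector_Spaces.linear_def module_hom_def module_hom_axioms_def vector_space_smul
      module_iff_vector_space linear_contractionD[OF assms])

lemma linear_contraction_L_T1: "linear_contraction L_T1"
  unfolding linear_contraction_def
proof (intro conjI allI)
  fix x y :: "'a ell1" and c :: 'a
  show "L_T1 (x + y) = L_T1 x + L_T1 y"
    unfolding L_T1_def
    by (simp add: plus_ell1.rep_eq smul_add_left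
        infsum_add[OF smul_unit_vec_summable smul_unit_vec_summable] del: One_nat_def)
  show "L_T1 (smul c x) = smul c (L_T1 x)"
    unfolding L_T1_def
    using infsumI[OF has_sum_bounded_linear[OF bounded_linear_smul
          has_sum_infsum[OF smul_unit_vec_summable]]]
    by (simp add: smul.rep_eq flip: smul_smul)
  have le: "norm (smul (coord x n) (unit_vec (collatz n))) \<le> norm (coord x n)" for n
    unfolding norm_smul by (rule mult_left_le[OF norm_unit_vec_le norm_ge_zero])
  have "(\<lambda>n. norm (smul (coord x n) (unit_vec (collatz n)))) summable_on {1..}"
    by (rule summable_on_comparison_test[OF coord_summable[of x]]) (use le in auto)
  then show "norm (L_T1 x) \<le> norm x"
    unfolding L_T1_def norm_ell1_def[of x]
    by (intro order_trans[OF norm_infsum_bound] infsum_mono coord_summable le)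
qed

lemma linear_contraction_funpow:
  assumes "linear_contraction F"
  shows "linear_contraction (F ^^ j)"
  using assms by (induction j) (auto simp: linear_contraction_def intro: order_trans)

lemma linear_contraction_cesaro: "linear_contraction (cesaro k)"
proof -
  have L: "linear_contraction ((L_T1 :: 'a ell1 \<Rightarrow> _) ^^ j)" for j
    by (rule linear_contraction_funpow[OF linear_contraction_L_T1])
  show ?thesis
    unfolding linear_contraction_def
  proof (intro conjI allI)
    fix x y :: "'a ell1" and c :: 'a
    show "cesaro k (x + y) = cesaro k x + cesaro k y"
      using L by (simp add: linear_contraction_def cesaro_def sum.distrib scaleR_add_right)
    show "cesaro k (smul c x) = smul c (cesaro k x)"
      using L by (simp add: linear_contraction_def cesaro_def smul_scaleR
          linear_sum[OF bounded_linear.linear[OF bounded_linear_smul]])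
    have "norm (\<Sum>j<k. (L_T1 ^^ j) x) \<le> real (card {..<k}) * norm x"
      using L by (intro sum_norm_bound) (simp add: linear_contraction_def)
    then show "norm (cesaro k x) \<le> norm x"
      by (cases "k = 0") (simp_all add: cesaro_def field_simps)
  qed
qed

lemma L_T1_unit_vec: "L_T1 (unit_vec n) = unit_vec (collatz n)"
proof (cases "n = 0")
  case True
  have "unit_vec 0 = (0 :: 'a ell1)"
    by transfer auto
  with True show ?thesis
    using linear_0[OF bounded_linear.linear[OF
        linear_contraction_bounded_linear[OF linear_contraction_L_T1]]]
    by (simp add: collatz_def)
next
  case False
  have smul_simps: "smul 1 x = x" "smul 0 x = 0" for x :: "'a ell1"
    by (transfer; simp)+
  have "L_T1 (unit_vec n :: 'a ell1) = (\<Sum>\<^sub>\<infinity>m\<in>{n}. unit_vec (collatz m))"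
    unfolding L_T1_def using False
    by (intro infsum_cong_neutral) (auto simp: unit_vec.rep_eq smul_simps)
  then show ?thesis by simp
qed

lemma L_T1_funpow_unit_vec: "(L_T1 ^^ j) (unit_vec n) = unit_vec ((collatz ^^ j) n)"
  by (induction j) (simp_all add: L_T1_unit_vec)

section \<open>The average operator\<close>

lemma convergent_cesaro_unit_vec:
  assumes "\<not> filterlim (\<lambda>k. (collatz ^^ k) n) at_top sequentially"
  shows "convergent (\<lambda>k. cesaro k (unit_vec n))"
proof -
  obtain m p where "p > 0" "\<And>j. j \<ge> m \<Longrightarrow> (collatz ^^ (j + p)) n = (collatz ^^ j) n"
    using nondivergent_orbit_eventually_periodic[OF assms] by blast
  then show ?thesis
    unfolding cesaro_def L_T1_funpow_unit_vec
    using cesaro_means_eventually_periodic[of p m "\<lambda>j. unit_vec ((collatz ^^ j) n)"]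
    by (intro convergentI) simp
qed

lemma convergent_cesaro:
  fixes x :: "'a::{real_normed_field, banach} ell1"
  assumes nodiv: "\<And>n. n \<ge> 1 \<Longrightarrow> \<not> filterlim (\<lambda>k. (collatz ^^ k) n) at_top sequentially"
  shows "convergent (\<lambda>k. cesaro k x)"
proof -
  let ?S = "{x :: 'a ell1. convergent (\<lambda>k. cesaro k x)}"
  note C = linear_contractionD[OF linear_contraction_cesaro]
  have "dist (cesaro k x) (cesaro k y) \<le> dist x y" for k and x y :: "'a ell1"
    using linear_contractionD(3)[OF linear_contraction_cesaro, of k "x - y"]
      linear_diff[OF bounded_linear.linear[OF linear_contraction_bounded_linear], of "cesaro k" x y]
    by (simp add: dist_norm linear_contraction_cesaro)
  then have "closed ?S"
    by (rule closed_convergent_points)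
  moreover have "(\<Sum>n\<in>F. smul (coord x n) (unit_vec n)) \<in> ?S" if "finite F" "F \<subseteq> {1..}" for F
  proof -
    have "convergent (\<lambda>k. \<Sum>n\<in>F. smul (coord x n) (cesaro k (unit_vec n)))"
      using that nodiv
      by (intro convergent_sum bounded_linear.convergent[OF bounded_linear_smul]
          convergent_cesaro_unit_vec) auto
    then show ?thesis
      by (simp add: C linear_sum[OF bounded_linear.linear[OF
            linear_contraction_bounded_linear[OF linear_contraction_cesaro]]])
  qed
  then have "\<forall>\<^sub>F F in finite_subsets_at_top {1..}. (\<Sum>n\<in>F. smul (coord x n) (unit_vec n)) \<in> ?S"
    by (intro eventually_finite_subsets_at_top_weakI) auto
  ultimately have "x \<in> ?S"
    by (rule Lim_in_closed_set[OF _ _ finite_subsets_at_top_neq_bot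
          ell1_expansion[unfolded has_sum_def]])
  then show ?thesis by simp
qed

lemma linear_contraction_average_operator:
  assumes "\<And>x :: 'a::{real_normed_field, banach} ell1. convergent (\<lambda>k. cesaro k x)"
  shows "linear_contraction (average_operator :: 'a ell1 \<Rightarrow> 'a ell1)"
  unfolding linear_contraction_def
proof (intro conjI allI)
  fix x y :: "'a ell1" and c :: 'a
  have lim: "(\<lambda>k. cesaro k z) \<longlonglongrightarrow> average_operator z" for z :: "'a ell1"
    unfolding average_operator_def using assms by (simp add: convergent_LIMSEQ_iff)
  note C = linear_contractionD[OF linear_contraction_cesaro]
  show "average_operator (x + y) = average_operator x + average_operator y"
    by (rule LIMSEQ_unique[OF lim]) (simp add: C tendsto_add lim)
  show "average_operator (smul c x) = smul c (average_operator x)"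
    by (rule LIMSEQ_unique[OF lim])
       (simp add: C bounded_linear.tendsto[OF bounded_linear_smul] lim)
  show "norm (average_operator x) \<le> norm x"
    by (rule LIMSEQ_le_const2[OF tendsto_norm[OF lim]]) (auto simp: C)
qed

lemma average_operator_fixed_point:
  assumes "L_T1 x = x"
  shows "average_operator x = x"
proof -
  have fixed: "(L_T1 ^^ j) x = x" for j
    using assms by (induction j) simp_all
  have "\<forall>\<^sub>F k in sequentially. cesaro k x = x"
    using eventually_gt_at_top[of "0::nat"]
    by eventually_elim (simp add: cesaro_def fixed sum_constant_scaleR)
  then show ?thesis
    unfolding average_operator_def by (intro limI tendsto_eventually)
qed

text \<open>The Collatz map swaps 1 and 2.\<close>

lemma nonzero_L_T1_fixed_point:
  defines "u \<equiv> unit_vec 1 + unit_vec 2 :: 'a::{real_normed_field, banach} ell1"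
  shows "L_T1 u = u" "u \<noteq> 0"
  unfolding u_def
proof -
  show "L_T1 (unit_vec 1 + unit_vec 2) = unit_vec 1 + (unit_vec 2 :: 'a ell1)"
    by (simp add: linear_contractionD[OF linear_contraction_L_T1] L_T1_unit_vec collatz_def add.commute)
  have "coord (unit_vec 1 + unit_vec 2 :: 'a ell1) 1 = 1"
    by (simp add: plus_ell1.rep_eq unit_vec.rep_eq)
  then show "unit_vec 1 + unit_vec 2 \<noteq> (0 :: 'a ell1)"
    by (metis zero_ell1.rep_eq zero_neq_one)
qed

theorem theorem6p2:
  assumes "\<not> (\<exists>n\<ge>1. filterlim (\<lambda>k. (collatz ^^ k) n) at_top sequentially)"
  shows "(\<forall>x :: 'a::{real_normed_field, banach} ell1. convergent (\<lambda>k. cesaro k x))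
    \<and> Vector_Spaces.linear smul smul (average_operator :: 'a ell1 \<Rightarrow> 'a ell1)
    \<and> bounded_linear (average_operator :: 'a ell1 \<Rightarrow> 'a ell1)
    \<and> onorm (average_operator :: 'a ell1 \<Rightarrow> 'a ell1) = 1"
proof -
  let ?K = "average_operator :: 'a ell1 \<Rightarrow> 'a ell1"
  let ?x = "unit_vec 1 + unit_vec 2 :: 'a ell1"
  have conv: "convergent (\<lambda>k. cesaro k x)" for x :: "'a ell1"
    using assms by (intro convergent_cesaro) blast
  then have K: "linear_contraction ?K"
    by (rule linear_contraction_average_operator)
  then have bl: "bounded_linear ?K"
    by (rule linear_contraction_bounded_linear)
  have "onorm ?K \<le> 1"
    using K by (intro onorm_bound) (simp_all add: linear_contraction_def)
  moreover have "norm (?K ?x) / norm ?x \<le> onorm ?K"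
    by (rule le_onorm[OF bl])
  then have "1 \<le> onorm ?K"
    using nonzero_L_T1_fixed_point[where 'a = 'a] by (simp add: average_operator_fixed_point)
  ultimately show ?thesis
    using conv bl linear_contraction_linear[OF K] by auto
qed

end
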